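(* Let $X$ be a finite-dimensional complex Banach space and let $T:X\to X$ be a diffeomorphism with fixed point $0$, having a power series around $0$, whose differential $T'(0)$ is diagonalizable with nonzero eigenvalues and has non-resonant principle eigenfunctions. Let $\Phi_k=I_X+Q_k$ ($k\ge2$) be normal form transformations of $T$ (see context) and let $\tau_m=\Phi_2\circ\cdots\circ\Phi_m$ for $m\ge2$. Then for all $m\ge2$, $\tau_m\in X\otimes\mathcal A_{T'(0)}$.
   Context: Let $n=\dim X$, $\{e_1,\dots,e_n\}$ a basis of eigenvectors, $T'(0)e_i=\lambda_ie_i$, with dual basis $\{\phi_1,\dots,\phi_n\}\subset X^*$ (the principle eigenfunctions of the Koopman operator $U_{T'(0)}f=f\circ T'(0)$). They are non-resonant if $\lambda_j\ne\lambda_1^{\alpha_1}\cdots\lambda_n^{\alpha_n}$ for all $j$ and all $\alpha\in\mathbb N_0^n$ with $|\alpha|=\alpha_1+\dots+\alpha_n\ge2$. The principle algebra $\mathcal A_{T'(0)}\subset C(X)$ is the complex algebra generated by $\phi_1,\dots,\phi_n$ together with the constant functions. $X\otimes\mathcal A_{T'(0)}$ is identified with the space of maps $X\to X$ that are finite sums of maps $x\mapsto f(x)\,y$ with $f\in\mathcal A_{T'(0)}$, $y\in X$ (i.e. the $X$-valued polynomials on $X$). $\mathcal P({}^kX;X)$ is the space of continuous $k$-homogeneous polynomials $X\to X$, i.e. maps $x\mapsto A(x,\dots,x)$ with $A$ a $k$-linear map $X^k\to X$; $B_r=\{x:\|x\|<r\}$. Normal form transformations: for each $k\ge2$, $Q_k\in\mathcal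 P({}^kX;X)$, $\Phi_k=I_X+Q_k$ is invertible from some ball $B_{\epsilon_k}$, $0<\epsilon_k<1$, onto its image with $C^1$ inverse, and with $T_1=T$, $T_k=\Phi_k^{-1}\circ T_{k-1}\circ\Phi_k$ one has near $0$ $T_k(z)=T'(0)z+R_{k+1}(z)$ with $R_{k+1}$ a power series about $0$ (a sum $\sum_jP_j$ of homogeneous polynomials, convergent near $0$), $R_{k+1}(z)\in\mathcal O(\|z\|^{k+1})$ as $z\to0$. Here $\tau_m$ is regarded as the polynomial map given by the composition. *)

theory Defs
  imports "HOL-Analysis.Analysis" "HOL-Library.Landau_Symbols"
begin

class complex_normed_vector = real_normed_vector +
  fixes scaleC :: "complex \<Rightarrow> 'a \<Rightarrow> 'a" (infixr "*\<^sub>C" 75)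
  assumes scaleC_add_right: "a *\<^sub>C (x + y) = a *\<^sub>C x + a *\<^sub>C y"
    and scaleC_add_left: "(a + b) *\<^sub>C x = a *\<^sub>C x + b *\<^sub>C x"
    and scaleC_scaleC: "a *\<^sub>C b *\<^sub>C x = (a * b) *\<^sub>C x"
    and scaleC_one: "1 *\<^sub>C x = x"
    and scaleR_scaleC: "r *\<^sub>R x = complex_of_real r *\<^sub>C x"
    and norm_scaleC: "norm (a *\<^sub>C x) = cmod a * norm x"

global_interpretation complex_vector: vector_space "scaleC :: complex \<Rightarrow> 'a \<Rightarrow> 'a::complex_normed_vector"
  by unfold_locales (simp_all add: scaleC_add_right scaleC_add_left scaleC_scaleC scaleC_one)

instantiation complex :: complex_normed_vector
begin

definition scaleC_complex :: "complex \<Rightarrow> complex \<Rightarrow> complex"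
  where "scaleC_complex a x = a * x"

instance
  by standard (simp_all add: scaleC_complex_def algebra_simps norm_mult scaleR_conv_of_real)

end

abbreviation clinear :: "('a::complex_normed_vector \<Rightarrow> 'b::complex_normed_vector) \<Rightarrow> bool"
  where "clinear \<equiv> Vector_Spaces.linear scaleC scaleC"

definition basis_family :: "nat \<Rightarrow> (nat \<Rightarrow> 'a::complex_normed_vector) \<Rightarrow> bool"
  where "basis_family n e \<longleftrightarrow>
    inj_on e {1..n} \<and> complex_vector.independent (e ` {1..n}) \<and>
    complex_vector.span (e ` {1..n}) = UNIV"

definition dual_basis_family ::
    "nat \<Rightarrow> (nat \<Rightarrow> 'a::complex_normed_vector) \<Rightarrow> (nat \<Rightarrow> 'a \<Rightarrow> complex) \<Rightarrow> bool"
  where "dual_basis_family n e \<phi> \<longleftrightarrow>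
    (\<forall>i\<in>{1..n}. clinear (\<phi> i) \<and> continuous_on UNIV (\<phi> i) \<and>
      (\<forall>j\<in>{1..n}. \<phi> i (e j) = (if i = j then 1 else 0)))"

definition non_resonant :: "nat \<Rightarrow> (nat \<Rightarrow> complex) \<Rightarrow> bool"
  where "non_resonant n lam \<longleftrightarrow>
    (\<forall>j\<in>{1..n}. \<forall>\<alpha> :: nat \<Rightarrow> nat.
      (\<Sum>i=1..n. \<alpha> i) \<ge> 2 \<longrightarrow> lam j \<noteq> (\<Prod>i=1..n. lam i ^ \<alpha> i))"

definition complex_subalgebra :: "('a \<Rightarrow> complex) set \<Rightarrow> bool"
  where "complex_subalgebra A \<longleftrightarrow>
    (\<lambda>x. 0) \<in> A \<and>
    (\<forall>f\<in>A. \<forall>g\<in>A. (\<lambda>x. f x + g x) \<in> A) \<and>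
    (\<forall>f\<in>A. \<forall>g\<in>A. (\<lambda>x. f x * g x) \<in> A) \<and>
    (\<forall>c. \<forall>f\<in>A. (\<lambda>x. c * f x) \<in> A)"

definition principle_algebra :: "nat \<Rightarrow> (nat \<Rightarrow> 'a \<Rightarrow> complex) \<Rightarrow> ('a \<Rightarrow> complex) set"
  where "principle_algebra n \<phi> = complex_subalgebra hull (\<phi> ` {1..n} \<union> range (\<lambda>c x. c))"

text \<open>The image of the tensor product of the space with \<open>A\<close> in the space of maps.\<close>
definition tensor_maps :: "('a \<Rightarrow> complex) set \<Rightarrow> ('a \<Rightarrow> 'b::complex_normed_vector) set"
  where "tensor_maps A =
    {F. \<exists>(N::nat) f y. (\<forall>j<N. f j \<in> A) \<and> F = (\<lambda>x. \<Sum>j<N. f j x *\<^sub>C y j)}"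

text \<open>A \<open>k\<close>-linear map is a function on lists of which only the values on lists of
  length \<open>k\<close> matter.\<close>
definition k_linear :: "nat \<Rightarrow> ('a::complex_normed_vector list \<Rightarrow> 'b::complex_normed_vector) \<Rightarrow> bool"
  where "k_linear k A \<longleftrightarrow>
    (\<forall>xs ys. length xs + length ys + 1 = k \<longrightarrow> clinear (\<lambda>z. A (xs @ z # ys)))"

definition homogeneous_polys ::
    "nat \<Rightarrow> ('a::complex_normed_vector \<Rightarrow> 'b::complex_normed_vector) set"
  where "homogeneous_polys k =
    {P. continuous_on UNIV P \<and> (\<exists>A. k_linear k A \<and> P = (\<lambda>x. A (replicate k x)))}"

definition power_series_at_0 ::
    "('a::complex_normed_vector \<Rightarrow> 'b::complex_normed_vector) \<Rightarrow> bool"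
  where "power_series_at_0 f \<longleftrightarrow>
    (\<exists>P. (\<forall>j. P j \<in> homogeneous_polys j) \<and>
      (\<exists>r>0. \<forall>z\<in>ball 0 r. (\<lambda>j. P j z) sums f z))"

text \<open>Differentiability is the library's, i.e. over the reals. As a hypothesis this is weaker
  than complex differentiability, hence covers both readings of a diffeomorphism of a complex
  space.\<close>
definition C1_on :: "('a::real_normed_vector \<Rightarrow> 'b::real_normed_vector) \<Rightarrow> 'a set \<Rightarrow> bool"
  where "C1_on f S \<longleftrightarrow>
    (\<exists>f' :: 'a \<Rightarrow> 'a \<Rightarrow>\<^sub>L 'b.
      (\<forall>x\<in>S. (f has_derivative blinfun_apply (f' x)) (at x)) \<and> continuous_on S f')"

definition diffeomorphism :: "('a::real_normed_vector \<Rightarrow> 'b::real_normed_vector) \<Rightarrow> bool"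
  where "diffeomorphism T \<longleftrightarrow> bij T \<and> C1_on T UNIV \<and> C1_on (inv T) UNIV"

text \<open>Here \<open>L\<close> is the differential of \<open>T\<close> at 0. The maps \<open>S k\<close> are the successive conjugates
  of \<open>T\<close>; they are constrained near 0 only, where the conjugation is defined, which is why
  the membership in the image of the ball is required before \<open>inv_into\<close> is used.\<close>
definition normal_form_transformations ::
    "('a::complex_normed_vector \<Rightarrow> 'a) \<Rightarrow> ('a \<Rightarrow> 'a) \<Rightarrow> (nat \<Rightarrow> 'a \<Rightarrow> 'a) \<Rightarrow> bool"
  where "normal_form_transformations T L \<Phi> \<longleftrightarrow>
    (\<exists>Q \<epsilon> S. S 1 = T \<and>
      (\<forall>k\<ge>2.
        Q k \<in> homogeneous_polys k \<and> \<Phi> k = (\<lambda>x. x + Q k x) \<and>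
        0 < \<epsilon> k \<and> \<epsilon> k < (1::real) \<and>
        inj_on (\<Phi> k) (ball 0 (\<epsilon> k)) \<and>
        C1_on (inv_into (ball 0 (\<epsilon> k)) (\<Phi> k)) (\<Phi> k ` ball 0 (\<epsilon> k)) \<and>
        (\<forall>\<^sub>F z in nhds 0. S (k - 1) (\<Phi> k z) \<in> \<Phi> k ` ball 0 (\<epsilon> k) \<and>
          S k z = inv_into (ball 0 (\<epsilon> k)) (\<Phi> k) (S (k - 1) (\<Phi> k z))) \<and>
        (\<exists>R. power_series_at_0 R \<and>
          (\<forall>\<^sub>F z in nhds 0. S k z = L z + R z) \<and>
          (\<lambda>z. norm (R z)) \<in> O[at 0](\<lambda>z. norm z ^ (k + 1)))))"

definition composed_transformation :: "(nat \<Rightarrow> 'a \<Rightarrow> 'a) \<Rightarrow> nat \<Rightarrow> 'a \<Rightarrow> 'a"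
  where "composed_transformation \<Phi> m = foldr (\<circ>) (map \<Phi> [2..<Suc m]) id"

end

theory Submission imports Defs begin

text \<open>A map belongs to the tensor product as soon as all its coordinates with respect to the
  eigenbasis lie in the algebra. Expanding the arguments of a \<open>k\<close>-linear map in the basis shows
  that this property of \<open>F\<close> is inherited by \<open>P \<circ> F\<close> for every homogeneous polynomial \<open>P\<close>, hence by
  \<open>\<Phi>\<^sub>k \<circ> F = F + Q\<^sub>k \<circ> F\<close>; the claim follows by starting from the identity.\<close>

lemma complex_subalgebra_zero: "complex_subalgebra A \<Longrightarrow> (\<lambda>x. 0) \<in> A"
  unfolding complex_subalgebra_def by blast

lemma complex_subalgebra_add:
  "complex_subalgebra A \<Longrightarrow> f \<in> A \<Longrightarrow> g \<in> A \<Longrightarrow> (\<lambda>x. f x + g x) \<in> A"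
  unfolding complex_subalgebra_def by blast

lemma complex_subalgebra_mult:
  "complex_subalgebra A \<Longrightarrow> f \<in> A \<Longrightarrow> g \<in> A \<Longrightarrow> (\<lambda>x. f x * g x) \<in> A"
  unfolding complex_subalgebra_def by blast

lemma complex_subalgebra_scale:
  "complex_subalgebra A \<Longrightarrow> f \<in> A \<Longrightarrow> (\<lambda>x. c * f x) \<in> A"
  unfolding complex_subalgebra_def by blast

text \<open>A hull is an intersection of all subalgebras containing the set, so it is itself a
  subalgebra because each closure condition passes to arbitrary intersections.\<close>

lemma complex_subalgebra_hull: "complex_subalgebra (complex_subalgebra hull S)"
proof (rule hull_in)
  fix T :: "('a \<Rightarrow> complex) set set"
  assume "Ball T complex_subalgebra"
  then have T: "complex_subalgebra A" if "A \<in> T" for A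
    using that by (rule bspec)
  show "complex_subalgebra (\<Inter> T)"
    unfolding complex_subalgebra_def
  proof (intro conjI ballI allI InterI)
    fix A f g c
    assume A: "A \<in> T"
    show "(\<lambda>x. 0) \<in> A"
      by (rule complex_subalgebra_zero[OF T[OF A]])
    assume "f \<in> \<Inter> T"
    with A have f: "f \<in> A" by (rule InterD[rotated])
    show "(\<lambda>x. c * f x) \<in> A"
      by (rule complex_subalgebra_scale[OF T[OF A] f])
    assume "g \<in> \<Inter> T"
    with A have g: "g \<in> A" by (rule InterD[rotated])
    show "(\<lambda>x. f x + g x) \<in> A"
      by (rule complex_subalgebra_add[OF T[OF A] f g])
    show "(\<lambda>x. f x * g x) \<in> A"
      by (rule complex_subalgebra_mult[OF T[OF A] f g])
  qed
qed

lemma complex_subalgebra_sum: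
  assumes "complex_subalgebra A" and "\<And>i. i \<in> I \<Longrightarrow> f i \<in> A"
  shows "(\<lambda>x. \<Sum>i\<in>I. f i x) \<in> A"
  using assms(2)
proof (induction I rule: infinite_finite_induct)
  case (insert i I)
  then have "f i \<in> A" and "(\<lambda>x. \<Sum>i\<in>I. f i x) \<in> A"
    by auto
  then have "(\<lambda>x. f i x + (\<Sum>i\<in>I. f i x)) \<in> A"
    by (rule complex_subalgebra_add[OF assms(1)])
  with insert.hyps show ?case
    by simp
\<comment> \<open>Empty and infinite index sets both give the zero function, so finiteness need not
  be assumed.\<close>
qed (simp_all add: complex_subalgebra_zero[OF assms(1)])

lemma subalgebra_principle_algebra: "complex_subalgebra (principle_algebra n \<phi>)"
  unfolding principle_algebra_def by (rule complex_subalgebra_hull)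

lemma const_in_principle_algebra: "(\<lambda>x. c) \<in> principle_algebra n \<phi>"
  unfolding principle_algebra_def by (rule hull_inc) blast

lemma eigenfunction_in_principle_algebra:
  "i \<in> {1..n} \<Longrightarrow> \<phi> i \<in> principle_algebra n \<phi>"
  unfolding principle_algebra_def by (rule hull_inc) blast

lemma clinear_sum_scaleC:
  assumes "clinear f"
  shows "f (\<Sum>i\<in>I. c i *\<^sub>C v i) = (\<Sum>i\<in>I. c i *\<^sub>C f (v i))"
proof -
  interpret f: Vector_Spaces.linear scaleC scaleC f by (fact assms)
  show ?thesis by (simp add: f.sum f.scale)
qed

text \<open>Spanning provides some coefficients; applying \<open>\<phi> i\<close> and using duality
  identifies the \<open>i\<close>-th one as \<open>\<phi> i x\<close>.\<close>

lemma basis_expansion: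
  fixes e :: "nat \<Rightarrow> 'a::complex_normed_vector"
  assumes e: "basis_family n e" and \<phi>: "dual_basis_family n e \<phi>"
  shows "x = (\<Sum>i=1..n. \<phi> i x *\<^sub>C e i)"
proof -
  have inj: "inj_on e {1..n}" and span: "x \<in> complex_vector.span (e ` {1..n})"
    using e by (simp_all add: basis_family_def)
  obtain u where "x = (\<Sum>v\<in>e ` {1..n}. u v *\<^sub>C v)"
    using span by (auto simp: complex_vector.span_finite)
  \<comment> \<open>The coefficients from the span are indexed by vectors; injectivity of
    \<open>e\<close> allows indexing by \<open>{1..n}\<close> instead.\<close>
  then have x: "x = (\<Sum>i=1..n. u (e i) *\<^sub>C e i)"
    unfolding sum.reindex[OF inj] by simp
  have "\<phi> i x = u (e i)" if i: "i \<in> {1..n}" for i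
  proof -
    have lin: "clinear (\<phi> i)" and d: "\<And>j. j \<in> {1..n} \<Longrightarrow> \<phi> i (e j) = (if i = j then 1 else 0)"
      using \<phi> i by (auto simp: dual_basis_family_def)
    have "\<phi> i x = (\<Sum>j=1..n. u (e j) * \<phi> i (e j))"
      using arg_cong[OF x, of "\<phi> i"] unfolding clinear_sum_scaleC[OF lin] scaleC_complex_def .
    also have "\<dots> = (\<Sum>j=1..n. if j = i then u (e i) else 0)"
      by (rule sum.cong) (auto simp: d)
    also have "\<dots> = u (e i)"
      using i by simp
    finally show ?thesis .
  qed
  then have "(\<Sum>i=1..n. \<phi> i x *\<^sub>C e i) = (\<Sum>i=1..n. u (e i) *\<^sub>C e i)"
    by (intro sum.cong) simp_all
  with x show ?thesis by (rule trans[OF _ sym])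
qed

text \<open>The basis expansion of \<open>F x\<close> already is a finite sum of the required form,
  with the coordinate functions as scalar factors and the basis vectors as constant ones.\<close>

lemma tensor_mapsI:
  assumes e: "basis_family n e" "dual_basis_family n e \<phi>"
    and F: "\<And>i. i \<in> {1..n} \<Longrightarrow> (\<lambda>x. \<phi> i (F x)) \<in> A"
  shows "F \<in> tensor_maps A"
proof -
  \<comment> \<open>The shift by \<open>Suc\<close> reconciles the basis, indexed from 1, with the
    sums in \<open>tensor_maps\<close>, indexed from 0.\<close>
  have "F x = (\<Sum>j<n. \<phi> (Suc j) (F x) *\<^sub>C e (Suc j))" for x
    using basis_expansion[OF e, of "F x"]
    by (simp add: sum.atLeast1_atMost_eq)
  then have "F = (\<lambda>x. \<Sum>j<n. \<phi> (Suc j) (F x) *\<^sub>C e (Suc j))"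
    by blast
  moreover have "(\<lambda>x. \<phi> (Suc j) (F x)) \<in> A" if "j < n" for j
    using that by (intro F) auto
  ultimately show ?thesis
    unfolding tensor_maps_def
    by (intro CollectI exI[of _ n] exI[of _ "\<lambda>j x. \<phi> (Suc j) (F x)"] exI[of _ "\<lambda>j. e (Suc j)"]) blast
qed

text \<open>The prefix \<open>ys\<close> holds the arguments that have already been replaced by basis vectors.\<close>

lemma multilinear_comp_in_algebra:
  assumes e: "basis_family n e" "dual_basis_family n e \<phi>"
    and A: "complex_subalgebra A" "\<And>c. (\<lambda>x. c) \<in> A"
    and F: "\<And>i. i \<in> {1..n} \<Longrightarrow> (\<lambda>x. \<phi> i (F x)) \<in> A"
    and B: "k_linear k B" and g: "clinear g"
    and "length ys + j = k"
  shows "(\<lambda>x. g (B (ys @ replicate j (F x)))) \<in> A"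
  using \<open>length ys + j = k\<close>
proof (induction j arbitrary: ys)
  case 0
  \<comment> \<open>Once every slot holds a fixed vector, the function is constant in
    \<open>x\<close>.\<close>
  then show ?case by (simp add: A(2))
next
  case (Suc j)
  \<comment> \<open>Linearity in the first slot still holding \<open>F x\<close> pulls out its
    coordinates; each summand is one of them times an instance of the induction hypothesis with
    prefix \<open>ys @ [e i]\<close>.\<close>
  have "g (B (ys @ replicate (Suc j) (F x))) =
      (\<Sum>i=1..n. \<phi> i (F x) * g (B ((ys @ [e i]) @ replicate j (F x))))" for x
  proof -
    have lin: "clinear (\<lambda>z. B (ys @ z # replicate j (F x)))"
      using B Suc.prems by (simp add: k_linear_def)
    have "B (ys @ replicate (Suc j) (F x)) =
        B (ys @ (\<Sum>i=1..n. \<phi> i (F x) *\<^sub>C e i) # replicate j (F x))"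
      \<comment> \<open>The expansion is folded back into \<open>F x\<close>: read left to right,
        its left-hand side is a bare variable and rewriting would loop.\<close>
      by (simp only: basis_expansion[OF e, symmetric] replicate_Suc)
    then show ?thesis
      by (simp add: clinear_sum_scaleC[OF lin] clinear_sum_scaleC[OF g] scaleC_complex_def)
  qed
  moreover have "(\<lambda>x. \<phi> i (F x) * g (B ((ys @ [e i]) @ replicate j (F x)))) \<in> A"
    if "i \<in> {1..n}" for i
  proof -
    have "(\<lambda>x. g (B ((ys @ [e i]) @ replicate j (F x)))) \<in> A"
      using Suc.prems by (intro Suc.IH) simp
    then show ?thesis
      by (rule complex_subalgebra_mult[OF A(1) F[OF that]])
  qed
  ultimately show ?case
    by (simp only: complex_subalgebra_sum[OF A(1)])
qed

text \<open>This is the multilinear statement with an empty prefix, all \<open>k\<close> slots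
  holding \<open>F x\<close>. The functional \<open>g\<close> will be a coordinate
  \<open>\<phi> i\<close>.\<close>

lemma homogeneous_poly_comp_in_algebra:
  assumes "basis_family n e" "dual_basis_family n e \<phi>"
    and "complex_subalgebra A" "\<And>c. (\<lambda>x. c) \<in> A"
    and "\<And>i. i \<in> {1..n} \<Longrightarrow> (\<lambda>x. \<phi> i (F x)) \<in> A"
    and P: "P \<in> homogeneous_polys k" and "clinear g"
  shows "(\<lambda>x. g (P (F x))) \<in> A"
proof -
  obtain B where "k_linear k B" and "P = (\<lambda>x. B (replicate k x))"
    using P by (auto simp: homogeneous_polys_def)
  then show ?thesis
    using multilinear_comp_in_algebra[OF assms(1-5) _ \<open>clinear g\<close>, of k B "[]" k] by simp
qed

theorem lemma4p1:
  fixes T L :: "'a::{complex_normed_vector, banach} \<Rightarrow> 'a"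
    and n :: nat
    and e :: "nat \<Rightarrow> 'a"
    and lam :: "nat \<Rightarrow> complex"
    and \<phi> :: "nat \<Rightarrow> 'a \<Rightarrow> complex"
    and \<Phi> :: "nat \<Rightarrow> 'a \<Rightarrow> 'a"
  assumes "\<exists>B :: 'a set. finite B \<and> complex_vector.span B = UNIV"
    and "n = complex_vector.dim (UNIV :: 'a set)"
    and "diffeomorphism T" and "T 0 = 0" and "power_series_at_0 T"
    and "(T has_derivative L) (at 0)" and "clinear L"
    and "basis_family n e"
    and "\<forall>i\<in>{1..n}. L (e i) = lam i *\<^sub>C e i"
    and "\<forall>i\<in>{1..n}. lam i \<noteq> 0"
    and "dual_basis_family n e \<phi>"
    and "non_resonant n lam"
    and "normal_form_transformations T L \<Phi>"
  shows "\<forall>m\<ge>2. composed_transformation \<Phi> m \<in> tensor_maps (principle_algebra n \<phi>)"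
proof (intro allI impI)
  fix m
  note e = \<open>basis_family n e\<close> and \<phi> = \<open>dual_basis_family n e \<phi>\<close>
  let ?A = "principle_algebra n \<phi>"
  obtain Q where Q: "\<And>k. k \<ge> 2 \<Longrightarrow> Q k \<in> homogeneous_polys k \<and> \<Phi> k = (\<lambda>x. x + Q k x)"
    using \<open>normal_form_transformations T L \<Phi>\<close> unfolding normal_form_transformations_def by blast
  have lin: "clinear (\<phi> i)" if "i \<in> {1..n}" for i
    using \<phi> that by (simp add: dual_basis_family_def)
  \<comment> \<open>Arbitrary index lists make the induction possible: removing the head strips the
    outermost map, and the tail of \<open>[2..<Suc m]\<close> no longer starts at 2.\<close>
  have "(\<lambda>x. \<phi> i (foldr (\<circ>) (map \<Phi> ks) id x)) \<in> ?A"
    if "\<forall>k\<in>set ks. k \<ge> 2" and "i \<in> {1..n}" for ks i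
    using that
  proof (induction ks arbitrary: i)
    case Nil
    then show ?case
      \<comment> \<open>The coordinates of the identity are the generators of the algebra.\<close>
      using eigenfunction_in_principle_algebra[of i n \<phi>] by simp
  next
    case (Cons k ks)
    define F where "F = foldr (\<circ>) (map \<Phi> ks) id"
    have F: "(\<lambda>x. \<phi> j (F x)) \<in> ?A" if "j \<in> {1..n}" for j
      unfolding F_def using Cons.prems(1) by (intro Cons.IH that) simp
    have k: "Q k \<in> homogeneous_polys k" "\<Phi> k = (\<lambda>x. x + Q k x)"
      using Q Cons.prems by auto
    interpret Vector_Spaces.linear scaleC scaleC "\<phi> i"
      using lin Cons.prems by blast
    have "(\<lambda>x. \<phi> i (Q k (F x))) \<in> ?A"
      using homogeneous_poly_comp_in_algebra[OF e \<phi> subalgebra_principle_algebra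
          const_in_principle_algebra F k(1)] lin Cons.prems by blast
    then have "(\<lambda>x. \<phi> i (F x) + \<phi> i (Q k (F x))) \<in> ?A"
      by (rule complex_subalgebra_add[OF subalgebra_principle_algebra F[OF Cons.prems(2)]])
    moreover have "foldr (\<circ>) (map \<Phi> (k # ks)) id x = F x + Q k (F x)" for x
      unfolding F_def by (simp add: k(2))
    ultimately show ?case
      by (simp only: add)
  qed
  moreover have "\<forall>k\<in>set [2..<Suc m]. k \<ge> 2"
    by auto
  ultimately show "composed_transformation \<Phi> m \<in> tensor_maps ?A"
    unfolding composed_transformation_def by (intro tensor_mapsI[OF e \<phi>]) blast
qed

end
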